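(* Let $\mathbf{x},\mathbf{y}\in\mathbb{R}^n$. Then $\mathbf{x}\prec_{\mathrm{w}}\mathbf{y}$ if and only if there is a $\mathbf{z}\in\mathbb{R}^n$ such that $\mathbf{x}\leq_{\mathrm{e}}\mathbf{z}$ and $\mathbf{z}\prec\mathbf{y}$.
   Context: For $\mathbf{x}=[x_i]\in\mathbb{R}^n$, let $x_{[1]}\geq x_{[2]}\geq\cdots\geq x_{[n]}$ denote the entries of $\mathbf{x}$ in decreasing order (with multiplicity). For $\mathbf{x},\mathbf{y}\in\mathbb{R}^n$: $\mathbf{x}\prec_{\mathrm{w}}\mathbf{y}$ ($\mathbf{x}$ is weakly majorized by $\mathbf{y}$) means $\sum_{i=1}^k x_{[i]}\leq\sum_{i=1}^k y_{[i]}$ for each $1\leq k\leq n$; $\mathbf{x}\prec\mathbf{y}$ ($\mathbf{x}$ is majorized by $\mathbf{y}$) means $\mathbf{x}\prec_{\mathrm{w}}\mathbf{y}$ and in addition $\sum_{i=1}^n x_i=\sum_{i=1}^n y_i$; and $\mathbf{x}\leq_{\mathrm{e}}\mathbf{y}$ means $x_j\leq y_j$ for all $1\leq j\leq n$. *)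

theory Defs
  imports "HOL-Analysis.Analysis" "HOL-Library.Multiset"
begin

definition decr_list :: "real ^ 'n \<Rightarrow> real list" where
  "decr_list x = rev (sorted_list_of_multiset (image_mset (\<lambda>i. x $ i) (mset_set UNIV)))"

lemma mset_decr_list: "mset (decr_list x) = image_mset (\<lambda>i. x $ i) (mset_set UNIV)"
  by (simp add: decr_list_def)

lemma sorted_decr_list: "sorted_wrt (\<ge>) (decr_list x)"
  by (simp add: decr_list_def sorted_wrt_rev)

lemma length_decr_list: "length (decr_list (x :: real ^ 'n)) = CARD('n)"
  by (metis mset_decr_list size_mset size_image_mset size_mset_set)

text \<open>The index \<open>i\<close> of \<open>x\<^sub>[\<^sub>i\<^sub>]\<close> runs from \<open>1\<close> to \<open>CARD('n)\<close>; outside this range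
  the value is meaningless.\<close>

definition decr :: "real ^ 'n \<Rightarrow> nat \<Rightarrow> real" where
  "decr x i = decr_list x ! (i - 1)"

definition weakly_majorized :: "real ^ 'n \<Rightarrow> real ^ 'n \<Rightarrow> bool" (infix \<open>\<prec>\<^sub>w\<close> 50) where
  "x \<prec>\<^sub>w y \<longleftrightarrow> (\<forall>k. 1 \<le> k \<and> k \<le> CARD('n) \<longrightarrow> (\<Sum>i=1..k. decr x i) \<le> (\<Sum>i=1..k. decr y i))"

definition majorized :: "real ^ 'n \<Rightarrow> real ^ 'n \<Rightarrow> bool" (infix \<open>\<prec>\<close> 50) where
  "x \<prec> y \<longleftrightarrow> x \<prec>\<^sub>w y \<and> (\<Sum>i\<in>UNIV. x $ i) = (\<Sum>i\<in>UNIV. y $ i)"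

text \<open>The entrywise order is the library's \<open>\<le>\<close> on \<open>real ^ 'n\<close>, see \<open>less_eq_vec_def\<close>.\<close>

end

theory Submission
  imports Defs
begin

text \<open>
  If \<open>x \<le> z\<close>, then every decreasingly ordered entry of \<open>x\<close> is at most the corresponding one of
  \<open>z\<close>, so \<open>z \<prec> y\<close> gives \<open>x \<prec>\<^sub>w y\<close>. Conversely, given \<open>x \<prec>\<^sub>w y\<close>, fill \<open>x\<close> up with water to a
  level \<open>t\<close>: put \<open>z\<^sub>i = max x\<^sub>i t\<close>, where the intermediate value theorem provides a \<open>t\<close> for
  which the entries of \<open>z\<close> have the same total as those of \<open>y\<close>. Where the decreasing
  rearrangement of \<open>z\<close> is above the level it agrees with that of \<open>x\<close>, so the partial sums there are
  bounded by hypothesis. Where it has reached the level it is constant; there the partial sums of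
  \<open>z\<close> are affine and those of \<open>y\<close> concave in their length, so the inequality between them,
  which holds at the start of this range and at the full length, where the two totals agree, holds
  in between as well (lemma \<open>partial_sums_max_le\<close>).

  Everything needed about rearrangements follows from the threshold criterion
  \<open>le_decr_iff\<close>: the \<open>k\<close>-th largest entry is at least \<open>v\<close> exactly if at least \<open>k\<close> entries are.
\<close>

lemma le_nth_iff_length_filter:
  fixes v :: "'a::linorder"
  assumes "sorted_wrt (\<ge>) xs" and "i < length xs"
  shows "v \<le> xs ! i \<longleftrightarrow> i < length (filter (\<lambda>a. v \<le> a) xs)"
  using assms
proof (induction xs arbitrary: i)
  case Nil
  then show ?case by simp
next
  case (Cons a xs)
  show ?case
  proof (cases "v \<le> a")
    case True
    with Cons show ?thesis by (cases i) auto
  next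
    case False
    with Cons.prems(1) have small: "\<forall>b\<in>set (a # xs). \<not> v \<le> b" by force
    then have "filter (\<lambda>a. v \<le> a) (a # xs) = []" by (simp add: filter_empty_conv)
    moreover have "\<not> v \<le> (a # xs) ! i"
      using small Cons.prems(2) nth_mem by blast
    ultimately show ?thesis by simp
  qed
qed

lemma le_decr_iff:
  fixes x :: "real ^ 'n"
  assumes "1 \<le> k" and "k \<le> CARD('n)"
  shows "v \<le> decr x k \<longleftrightarrow> k \<le> card {j. v \<le> x $ j}"
proof -
  have "length (filter (\<lambda>a. v \<le> a) (decr_list x))
      = size (filter_mset (\<lambda>a. v \<le> a) (mset (decr_list x)))"
    by (metis mset_filter size_mset)
  also have "\<dots> = card {j. v \<le> x $ j}"
    by (simp add: mset_decr_list filter_mset_image_mset)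
  finally have "length (filter (\<lambda>a. v \<le> a) (decr_list x)) = card {j. v \<le> x $ j}" .
  moreover have "k - 1 < length (decr_list x)"
    using assms by (simp add: length_decr_list)
  ultimately have "v \<le> decr x k \<longleftrightarrow> k - 1 < card {j. v \<le> x $ j}"
    using le_nth_iff_length_filter[OF sorted_decr_list, of "k - 1" x v] by (simp add: decr_def)
  with assms show ?thesis by linarith
qed

lemma decr_antimono:
  fixes x :: "real ^ 'n"
  assumes "1 \<le> i" and "i \<le> k" and "k \<le> CARD('n)"
  shows "decr x k \<le> decr x i"
proof -
  have "k \<le> card {j. decr x k \<le> x $ j}"
    using assms le_decr_iff[of k "decr x k" x] by simp
  with assms show ?thesis by (simp add: le_decr_iff)
qed

lemma decr_mono:
  fixes x z :: "real ^ 'n"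
  assumes "x \<le> z" and "1 \<le> k" and "k \<le> CARD('n)"
  shows "decr x k \<le> decr z k"
proof -
  have "k \<le> card {j. decr x k \<le> x $ j}"
    using assms le_decr_iff[of k "decr x k" x] by simp
  also have "\<dots> \<le> card {j. decr x k \<le> z $ j}"
    using assms(1) by (intro card_mono) (auto simp: less_eq_vec_def intro: order_trans)
  finally show ?thesis using assms by (simp add: le_decr_iff)
qed

lemma decr_max:
  fixes x :: "real ^ 'n"
  assumes "1 \<le> k" and "k \<le> CARD('n)"
  shows "decr (\<chi> j. max (x $ j) t) k = max (decr x k) t"
proof -
  have "v \<le> decr (\<chi> j. max (x $ j) t) k \<longleftrightarrow> v \<le> max (decr x k) t" for v
    using assms by (cases "v \<le> t") (simp_all add: le_decr_iff le_max_iff_disj)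
  then show ?thesis by (meson order_antisym order_refl)
qed

lemma sum_decr:
  fixes x :: "real ^ 'n"
  shows "(\<Sum>i=1..CARD('n). decr x i) = (\<Sum>j\<in>UNIV. x $ j)"
proof -
  have "(\<Sum>i=1..CARD('n). decr x i) = (\<Sum>i<CARD('n). decr_list x ! i)"
    by (rule sum.reindex_bij_witness[of _ Suc "\<lambda>i. i - 1"]) (auto simp: decr_def)
  also have "\<dots> = sum_mset (mset (decr_list x))"
    by (simp add: sum_mset_sum_list sum_list_sum_nth length_decr_list atLeast0LessThan)
  also have "\<dots> = (\<Sum>j\<in>UNIV. x $ j)"
    by (simp add: mset_decr_list sum_unfold_sum_mset)
  finally show ?thesis .
qed

text \<open>
  The heart of the argument, for two sequences that decrease on \<open>{1..n}\<close>: raising to a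
  common level \<open>t\<close> the entries of \<open>a\<close> below it keeps all partial sums below those of \<open>b\<close>, provided
  that this holds for the full sum.
\<close>

lemma partial_sums_max_le:
  fixes a b :: "nat \<Rightarrow> real"
  assumes a: "\<And>i k. 1 \<le> i \<Longrightarrow> i \<le> k \<Longrightarrow> k \<le> n \<Longrightarrow> a k \<le> a i"
    and b: "\<And>i k. 1 \<le> i \<Longrightarrow> i \<le> k \<Longrightarrow> k \<le> n \<Longrightarrow> b k \<le> b i"
    and le: "\<And>k. 1 \<le> k \<Longrightarrow> k \<le> n \<Longrightarrow> (\<Sum>i=1..k. a i) \<le> (\<Sum>i=1..k. b i)"
    and total: "(\<Sum>i=1..n. max (a i) t) \<le> (\<Sum>i=1..n. b i)"
    and "k \<le> n"
  shows "(\<Sum>i=1..k. max (a i) t) \<le> (\<Sum>i=1..k. b i)"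
  using \<open>k \<le> n\<close>
proof (induction k)
  case 0
  then show ?case by simp
next
  case (Suc k)
  consider "t \<le> a (Suc k)" | "a (Suc k) < t" "t \<le> b (Suc k)" | "b (Suc k) < t"
    by linarith
  then show ?case
  proof cases
    case 1
    have "t \<le> a i" if "i \<in> {1..Suc k}" for i
      using 1 a[of i "Suc k"] that Suc.prems by auto
    then have "(\<Sum>i=1..Suc k. max (a i) t) = (\<Sum>i=1..Suc k. a i)"
      by (intro sum.cong) auto
    then show ?thesis using le[of "Suc k"] Suc.prems by simp
  next
    case 2
    then show ?thesis using Suc by simp
  next
    case 3
    \<comment> \<open>All later entries of \<open>b\<close> lie below the level, so a deficit here could not be made up.\<close>
    have tail: "(\<Sum>i\<in>{Suc k<..n}. b i) \<le> (\<Sum>i\<in>{Suc k<..n}. max (a i) t)"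
    proof (rule sum_mono)
      fix i assume "i \<in> {Suc k<..n}"
      then show "b i \<le> max (a i) t" using 3 b[of "Suc k" i] by auto
    qed
    have "{1..n} = {1..Suc k} \<union> {Suc k<..n}" using Suc.prems by auto
    then have split: "(\<Sum>i=1..n. f i) = (\<Sum>i=1..Suc k. f i) + (\<Sum>i\<in>{Suc k<..n}. f i)"
      for f :: "nat \<Rightarrow> real"
      by (simp only:) (rule sum.union_disjoint; auto)
    show ?thesis
      using tail total split[of b] split[of "\<lambda>i. max (a i) t"] by linarith
  qed
qed

lemma exists_water_level:
  fixes x :: "real ^ 'n"
  assumes "(\<Sum>j\<in>UNIV. x $ j) \<le> s"
  obtains t where "(\<Sum>j\<in>UNIV. max (x $ j) t) = s"
proof -
  define f where "f t = (\<Sum>j\<in>UNIV. max (x $ j) t)" for t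
  define lo where "lo = Min (range (($) x))"
  define hi where "hi = max lo (s / CARD('n))"
  have "lo \<le> x $ j" for j by (simp add: lo_def)
  then have "f lo \<le> s" using assms by (simp add: f_def max_absorb1)
  moreover have "s \<le> f hi"
  proof -
    have "s = (\<Sum>j\<in>(UNIV :: 'n set). s / CARD('n))" by simp
    also have "\<dots> \<le> f hi" unfolding f_def hi_def by (intro sum_mono) simp
    finally show ?thesis .
  qed
  moreover have "lo \<le> hi" by (simp add: hi_def)
  moreover have "continuous_on {lo..hi} f"
    unfolding f_def by (intro continuous_intros)
  ultimately obtain t where "f t = s" using IVT'[of f lo s hi] by blast
  then show ?thesis using that by (simp add: f_def)
qed

theorem theorem7p5:
  fixes x y :: "real ^ 'n"
  shows "x \<prec>\<^sub>w y \<longleftrightarrow> (\<exists>z :: real ^ 'n. x \<le> z \<and> z \<prec> y)"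
proof
  assume xy: "x \<prec>\<^sub>w y"
  then have le: "(\<Sum>i=1..k. decr x i) \<le> (\<Sum>i=1..k. decr y i)"
    if "1 \<le> k" "k \<le> CARD('n)" for k
    using that by (simp add: weakly_majorized_def)
  have "(\<Sum>j\<in>UNIV. x $ j) \<le> (\<Sum>j\<in>UNIV. y $ j)"
    using le[of "CARD('n)"] sum_decr[of x] sum_decr[of y] by (simp add: Suc_le_eq)
  then obtain t where t: "(\<Sum>j\<in>UNIV. max (x $ j) t) = (\<Sum>j\<in>UNIV. y $ j)"
    by (rule exists_water_level)
  define z :: "real ^ 'n" where "z = (\<chi> j. max (x $ j) t)"
  have z_sum: "(\<Sum>j\<in>UNIV. z $ j) = (\<Sum>j\<in>UNIV. y $ j)"
    using t by (simp add: z_def)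
  have z_partial: "(\<Sum>i=1..k. decr z i) = (\<Sum>i=1..k. max (decr x i) t)"
    if "k \<le> CARD('n)" for k
    using that by (intro sum.cong) (auto simp: z_def decr_max)
  have total: "(\<Sum>i=1..CARD('n). max (decr x i) t) \<le> (\<Sum>i=1..CARD('n). decr y i)"
    using z_sum z_partial[of "CARD('n)"] sum_decr[of z] sum_decr[of y] by linarith
  have "z \<prec>\<^sub>w y"
    unfolding weakly_majorized_def
  proof (intro allI impI)
    fix k assume k: "1 \<le> k \<and> k \<le> CARD('n)"
    have "(\<Sum>i=1..k. max (decr x i) t) \<le> (\<Sum>i=1..k. decr y i)"
      by (rule partial_sums_max_le[OF decr_antimono decr_antimono le total]) (use k in auto)
    then show "(\<Sum>i=1..k. decr z i) \<le> (\<Sum>i=1..k. decr y i)"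
      using z_partial k by simp
  qed
  then have "z \<prec> y" using z_sum by (simp add: majorized_def)
  moreover have "x \<le> z" by (simp add: z_def less_eq_vec_def)
  ultimately show "\<exists>z. x \<le> z \<and> z \<prec> y" by blast
next
  assume "\<exists>z. x \<le> z \<and> z \<prec> y"
  then obtain z where "x \<le> z" and zy: "z \<prec>\<^sub>w y" by (auto simp: majorized_def)
  show "x \<prec>\<^sub>w y"
    unfolding weakly_majorized_def
  proof (intro allI impI)
    fix k assume k: "1 \<le> k \<and> k \<le> CARD('n)"
    have "(\<Sum>i=1..k. decr x i) \<le> (\<Sum>i=1..k. decr z i)"
      using \<open>x \<le> z\<close> k by (intro sum_mono decr_mono) auto
    also have "\<dots> \<le> (\<Sum>i=1..k. decr y i)"
      using zy k by (simp add: weakly_majorized_def)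
    finally show "(\<Sum>i=1..k. decr x i) \<le> (\<Sum>i=1..k. decr y i)" .
  qed
qed

end
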